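(* Suppose $g$ is differentiable, strongly convex with constant $\eta_g>0$, with $\nabla_\theta g$ Lipschitz continuous with constant $G_g$; $F(\cdot;\theta)$ is monotone on $X$ for each $\theta\in\Theta$; $\|F(x_1;\theta)-F(x_2;\theta)\|\le L_{F,x}\|x_1-x_2\|$ for all $x_1,x_2\in X$, $\theta\in\Theta$; $\|F(x;\theta_1)-F(x;\theta_2)\|\le L_{F,\theta}\|\theta_1-\theta_2\|$ for all $\theta_1,\theta_2\in\Theta$, $x\in X$; and $\Theta$ is bounded. Let $\theta^*$ be the minimizer of $g$ over $\Theta$ and let $X^*$ be the solution set of $\mathrm{VI}(X,F(\cdot;\theta^* ))$. Let $0<\gamma_g<2/G_g$ and let $\{(x_k,\theta_k)\}$ be generated by the joint extragradient scheme with steplength $\tau>0$ satisfying $$\tau^2<\frac{1}{L_{F,x}^2+2L_{F,\theta}\|\theta_0-\theta^*\|}.$$ Then $\{x_k\}$ converges to a point in $X^*$ and $\{\theta_k\}$ converges to $\theta^*$ as $k\to\infty$.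
   Context: $X\subseteq\mathbb{R}^n$ and $\Theta\subseteq\mathbb{R}^m$ are nonempty closed convex sets, $F:X\times\Theta\to\mathbb{R}^n$, $g:\mathbb{R}^m\to\mathbb{R}$. $\mathrm{VI}(X,F(\cdot;\theta))$ asks for $x\in X$ with $(y-x)^TF(x;\theta)\ge0$ for all $y\in X$; $X^*$ is assumed nonempty. $F(\cdot;\theta)$ is monotone on $X$ if $(F(x;\theta)-F(y;\theta))^T(x-y)\ge0$ for all $x,y\in X$. A differentiable function $h$ is strongly convex with constant $\eta$ if $(\nabla h(u)-\nabla h(v))^T(u-v)\ge\eta\|u-v\|^2$ for all $u,v$. $\Pi_Y$ denotes Euclidean projection onto $Y$. The joint extragradient scheme, given $x_0\in X$, $\theta_0\in\Theta$ and steplengths $\tau,\gamma_g$, is: for all $k\ge0$, $z_{k+1}=\Pi_X(x_k-\tau F(x_k;\theta_k))$, $x_{k+1}=\Pi_X(x_k-\tau F(z_{k+1};\theta_k))$, $\theta_{k+1}=\Pi_\Theta(\theta_k-\gamma_g\nabla_\theta g(\theta_k))$. *)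

theory Defs
  imports "HOL-Analysis.Analysis"
begin

definition gradient :: "('a::real_inner \<Rightarrow> real) \<Rightarrow> 'a \<Rightarrow> 'a" where
  "gradient h x = (THE d. GDERIV h x :> d)"

lemma gradient_eq:
  assumes "GDERIV h x :> d"
  shows "gradient h x = d"
  unfolding gradient_def
proof (rule the_equality)
  show "GDERIV h x :> d" by fact
  fix e assume "GDERIV h x :> e"
  then have "(\<lambda>u. inner u e) = (\<lambda>u. inner u d)"
    using assms unfolding gderiv_def by (blast intro: has_derivative_unique)
  then show "e = d"
    by (metis inner_commute vector_eq_rdot)
qed

lemma GDERIV_gradient:
  fixes h :: "'a::euclidean_space \<Rightarrow> real"
  assumes "h differentiable (at x)"
  shows "GDERIV h x :> gradient h x"
proof -
  obtain D where D: "(h has_derivative D) (at x)"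
    using assms unfolding differentiable_def by blast
  interpret linear D using D by (rule has_derivative_linear)
  define d where "d = (\<Sum>b\<in>Basis. D b *\<^sub>R b)"
  have "D u = inner u d" for u
  proof -
    have "D u = D (\<Sum>b\<in>Basis. (u \<bullet> b) *\<^sub>R b)"
      by (simp add: euclidean_representation)
    also have "\<dots> = (\<Sum>b\<in>Basis. (u \<bullet> b) * D b)"
      by (simp add: sum scaleR)
    also have "\<dots> = inner u d"
      by (simp add: d_def inner_sum_right mult.commute)
    finally show ?thesis .
  qed
  then have "D = (\<lambda>u. inner u d)" by auto
  then have "GDERIV h x :> d" using D by (simp add: gderiv_def)
  then show ?thesis by (simp add: gradient_eq)
qed

definition strongly_convex :: "('a::real_inner \<Rightarrow> real) \<Rightarrow> real \<Rightarrow> bool" where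
  "strongly_convex h \<eta> \<longleftrightarrow> h differentiable_on UNIV \<and>
     (\<forall>u v. (gradient h u - gradient h v) \<bullet> (u - v) \<ge> \<eta> * (norm (u - v))\<^sup>2)"

definition VI_solutions :: "'a::real_inner set \<Rightarrow> ('a \<Rightarrow> 'a) \<Rightarrow> 'a set" where
  "VI_solutions X G = {x \<in> X. \<forall>y\<in>X. (y - x) \<bullet> G x \<ge> 0}"

text \<open>Monotonicity of an operator on an inner product space; unrelated to the order-theoretic
  \<^const>\<open>monotone_on\<close>.\<close>

definition monotone_operator_on :: "'a::real_inner set \<Rightarrow> ('a \<Rightarrow> 'a) \<Rightarrow> bool" where
  "monotone_operator_on X G \<longleftrightarrow> (\<forall>x\<in>X. \<forall>y\<in>X. (G x - G y) \<bullet> (x - y) \<ge> 0)"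

text \<open>The entry \<open>z 0\<close> is never used and stays unconstrained. \<^const>\<open>closest_point\<close> is
  the Euclidean projection when the target set is nonempty, closed and convex.\<close>

definition joint_extragradient ::
  "'a::euclidean_space set \<Rightarrow> 'b::euclidean_space set \<Rightarrow> ('a \<Rightarrow> 'b \<Rightarrow> 'a) \<Rightarrow> ('b \<Rightarrow> real) \<Rightarrow>
   real \<Rightarrow> real \<Rightarrow> (nat \<Rightarrow> 'a) \<Rightarrow> (nat \<Rightarrow> 'a) \<Rightarrow> (nat \<Rightarrow> 'b) \<Rightarrow> bool" where
  "joint_extragradient X \<Theta> F g \<tau> \<gamma> x z \<theta> \<longleftrightarrow>
     x 0 \<in> X \<and> \<theta> 0 \<in> \<Theta> \<and>
     (\<forall>k. z (Suc k) = closest_point X (x k - \<tau> *\<^sub>R F (x k) (\<theta> k)) \<and>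
          x (Suc k) = closest_point X (x k - \<tau> *\<^sub>R F (z (Suc k)) (\<theta> k)) \<and>
          \<theta> (Suc k) = closest_point \<Theta> (\<theta> k - \<gamma> *\<^sub>R gradient g (\<theta> k)))"

end

theory Submission
  imports Defs
begin

text \<open>The parameter iterates contract towards \<open>\<theta>_star\<close>: a convex function with Lipschitz gradient has a
  cocoercive gradient (Baillon-Haddad), so together with strong convexity the projected gradient
  step is a contraction for every steplength below \<open>2 / G\<close>. Hence the errors \<open>norm (\<theta> k - \<theta>_star)\<close>
  are summable. The extragradient inequality at a solution \<open>p\<close> then holds up to a summable
  perturbation, i.e. \<open>(norm (x k - p))\<^sup>2\<close> is quasi-Fejer monotone: it converges, and
  \<open>x k - z (k + 1)\<close> tends to 0. Every cluster point of \<open>x\<close> is a fixed point of the projection map,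
  hence a solution, and quasi-Fejer monotonicity relative to that cluster point gives convergence
  of the whole sequence.\<close>

section \<open>Projections and variational inequalities\<close>

text \<open>The obtuse-angle inequality pins down the projection: test it at \<open>p\<close> with
  \<open>?c\<close>, at \<open>?c\<close> with \<open>p\<close>, and add.\<close>

lemma closest_point_eqI:
  fixes S :: "'a::euclidean_space set"
  assumes S: "closed S" "convex S" and p: "p \<in> S"
    and le: "\<And>y. y \<in> S \<Longrightarrow> (a - p) \<bullet> (y - p) \<le> 0"
  shows "closest_point S a = p"
proof -
  let ?c = "closest_point S a"
  have c: "?c \<in> S" using S p closest_point_in_set by blast
  have "(a - p) \<bullet> (?c - p) \<le> 0" using le c by blast
  moreover have "(a - ?c) \<bullet> (p - ?c) \<le> 0"
    using closest_point_dot[of S p a] S p by blast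
  ultimately have "(?c - p) \<bullet> (?c - p) \<le> 0"
    by (simp add: inner_diff_left inner_diff_right inner_commute)
  then show ?thesis by (simp flip: power2_norm_eq_inner)
qed

text \<open>Serves twice: to recognise a cluster point of the iterates as a solution, and to see the
  minimizer of \<open>g\<close> as a fixed point of the projected gradient step.\<close>

lemma VI_solutions_iff_closest_point:
  fixes X :: "'a::euclidean_space set"
  assumes X: "closed X" "convex X" and "\<tau> > 0" and p: "p \<in> X"
  shows "p \<in> VI_solutions X A \<longleftrightarrow> closest_point X (p - \<tau> *\<^sub>R A p) = p"
proof
  assume "p \<in> VI_solutions X A"
  then show "closest_point X (p - \<tau> *\<^sub>R A p) = p"
    using \<open>\<tau> > 0\<close> by (intro closest_point_eqI X p)
      (auto simp: VI_solutions_def inner_commute)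
next
  assume *: "closest_point X (p - \<tau> *\<^sub>R A p) = p"
  have "(y - p) \<bullet> A p \<ge> 0" if "y \<in> X" for y
  proof -
    have "0 \<le> \<tau> * (A p \<bullet> (y - p))"
      using closest_point_dot[of X y "p - \<tau> *\<^sub>R A p"] X that * by simp
    then show ?thesis using \<open>\<tau> > 0\<close> by (simp add: zero_le_mult_iff inner_commute)
  qed
  then show "p \<in> VI_solutions X A" using p by (simp add: VI_solutions_def)
qed

text \<open>Korpelevich's estimate at an arbitrary \<open>p\<close> in \<open>X\<close>. The last
  term is nonpositive if \<open>p\<close> solves the inequality for \<open>A\<close>; it is kept
  because \<open>p\<close> will solve the inequality of a nearby operator instead.\<close>

lemma extragradient_step:
  fixes X :: "'a::euclidean_space set"
  assumes X: "closed X" "convex X"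
    and mono: "monotone_operator_on X A" and lip: "L-lipschitz_on X A"
    and \<tau>: "\<tau> \<ge> 0" and u: "u \<in> X" and p: "p \<in> X"
    and v: "v = closest_point X (u - \<tau> *\<^sub>R A u)"
    and w: "w = closest_point X (u - \<tau> *\<^sub>R A v)"
  shows "(norm (w - p))\<^sup>2 \<le>
    (norm (u - p))\<^sup>2 - (1 - \<tau>\<^sup>2 * L\<^sup>2) * (norm (u - v))\<^sup>2 + 2 * \<tau> * (A p \<bullet> (p - v))"
proof -
  have vX: "v \<in> X" and wX: "w \<in> X"
    using u X closest_point_in_set v w by blast+
  have 1: "(u - \<tau> *\<^sub>R A v - w) \<bullet> (p - w) \<le> 0"
    using closest_point_dot[of X p "u - \<tau> *\<^sub>R A v"] X p w by simp
  have 2: "(u - \<tau> *\<^sub>R A u - v) \<bullet> (w - v) \<le> 0"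
    using closest_point_dot[of X w "u - \<tau> *\<^sub>R A u"] X wX v by simp
  have "(A v - A p) \<bullet> (v - p) \<ge> 0"
    using mono vX p unfolding monotone_operator_on_def by blast
  then have 3: "\<tau> * ((A v - A p) \<bullet> (v - p)) \<ge> 0"
    using \<tau> by simp
  \<comment> \<open>The error of using \<open>A u\<close> in place of \<open>A v\<close> in the
    predictor. Young's inequality splits it so that its \<open>(norm (w - v))\<^sup>2\<close>
    cancels against the identity below.\<close>
  have "(A u - A v) \<bullet> (w - v) \<le> norm (A u - A v) * norm (w - v)"
    by (rule norm_cauchy_schwarz)
  also have "\<dots> \<le> L * norm (u - v) * norm (w - v)"
    using lipschitz_onD[OF lip u vX] by (intro mult_right_mono) (auto simp: dist_norm)
  finally have "2 * (\<tau> * ((A u - A v) \<bullet> (w - v))) \<le> 2 * (\<tau> * (L * norm (u - v) * norm (w - v)))"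
    using \<tau> by (intro mult_left_mono) auto
  also have "\<dots> = 2 * (\<tau> * L * norm (u - v)) * norm (w - v)"
    by (simp add: ac_simps)
  also have "\<dots> \<le> (\<tau> * L * norm (u - v))\<^sup>2 + (norm (w - v))\<^sup>2"
    by (rule sum_squares_bound)
  finally have 4: "2 * (\<tau> * ((A u - A v) \<bullet> (w - v))) \<le> \<tau>\<^sup>2 * L\<^sup>2 * (norm (u - v))\<^sup>2 + (norm (w - v))\<^sup>2"
    by (simp add: power_mult_distrib)
  have "(norm (w - p))\<^sup>2 = (norm (u - p))\<^sup>2 - (norm (u - v))\<^sup>2 - (norm (w - v))\<^sup>2
      + 2 * ((u - \<tau> *\<^sub>R A v - w) \<bullet> (p - w)) + 2 * ((u - \<tau> *\<^sub>R A u - v) \<bullet> (w - v))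
      + 2 * (\<tau> * ((A u - A v) \<bullet> (w - v))) - 2 * (\<tau> * ((A v - A p) \<bullet> (v - p)))
      + 2 * \<tau> * (A p \<bullet> (p - v))"
    by (simp add: power2_norm_eq_inner inner_diff_left inner_diff_right inner_commute algebra_simps)
  then show ?thesis using 1 2 3 4 by (simp add: algebra_simps)
qed

section \<open>Convex functions with Lipschitz gradient\<close>

lemma has_real_derivative_along_line:
  assumes "GDERIV g (x + t *\<^sub>R d) :> e"
  shows "((\<lambda>t. g (x + t *\<^sub>R d)) has_real_derivative e \<bullet> d) (at t)"
proof -
  have "((\<lambda>t. x + t *\<^sub>R d) has_derivative (\<lambda>h. h *\<^sub>R d)) (at t)"
    by (auto intro!: derivative_eq_intros)
  then have "((\<lambda>t. g (x + t *\<^sub>R d)) has_derivative (\<lambda>h. (h *\<^sub>R d) \<bullet> e)) (at t)"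
    using has_derivative_compose assms unfolding gderiv_def by blast
  moreover have "(\<lambda>h. (h *\<^sub>R d) \<bullet> e) = (*) (e \<bullet> d)"
    by (auto simp: inner_commute)
  ultimately show ?thesis by (simp add: has_field_derivative_def)
qed

context
  fixes g :: "'a::euclidean_space \<Rightarrow> real"
  assumes diff: "g differentiable_on UNIV"
begin

lemma GDERIV_gradient_UNIV: "GDERIV g x :> gradient g x"
  using diff by (intro GDERIV_gradient) (simp add: differentiable_on_def)

text \<open>Along the segment from \<open>x\<close> to \<open>y\<close>, \<open>g\<close> minus its
  linearization at \<open>x\<close> is nondecreasing, since monotonicity of the gradient makes its
  derivative nonnegative.\<close>

lemma gradient_le_of_monotone:
  assumes mono: "monotone_operator_on UNIV (gradient g)"
  shows "g x + gradient g x \<bullet> (y - x) \<le> g y"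
proof -
  let ?\<phi> = "\<lambda>t. g (x + t *\<^sub>R (y - x)) - t * (gradient g x \<bullet> (y - x))"
  have "?\<phi> 0 \<le> ?\<phi> 1"
  proof (rule DERIV_nonneg_imp_nondecreasing[where f = ?\<phi>])
    fix t :: real assume t: "0 \<le> t" "t \<le> 1"
    let ?w = "x + t *\<^sub>R (y - x)"
    have "(gradient g ?w - gradient g x) \<bullet> (?w - x) \<ge> 0"
      using mono unfolding monotone_operator_on_def by blast
    \<comment> \<open>Here \<open>?w - x\<close> is \<open>t\<close> times \<open>y - x\<close>, so
      \<open>t\<close> can be divided out; at \<open>t = 0\<close> the two gradients
      coincide.\<close>
    then have "t = 0 \<or> (gradient g ?w - gradient g x) \<bullet> (y - x) \<ge> 0"
      using t by (auto simp: zero_le_mult_iff)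
    then have "(gradient g ?w - gradient g x) \<bullet> (y - x) \<ge> 0" by auto
    moreover have "(?\<phi> has_real_derivative (gradient g ?w - gradient g x) \<bullet> (y - x)) (at t)"
      by (auto intro!: derivative_eq_intros has_real_derivative_along_line GDERIV_gradient_UNIV
          simp: inner_diff_left)
    ultimately show "\<exists>e. (?\<phi> has_real_derivative e) (at t) \<and> e \<ge> 0" by blast
  qed simp
  then show ?thesis by simp
qed

text \<open>The same comparison with a quadratic subtracted as well: its derivative dominates the
  growth of the gradient that the Lipschitz bound allows.\<close>

lemma descent_lemma:
  assumes lip: "G-lipschitz_on UNIV (gradient g)"
  shows "g y \<le> g x + gradient g x \<bullet> (y - x) + G / 2 * (norm (y - x))\<^sup>2"
proof -
  let ?d = "y - x"
  let ?\<phi> = "\<lambda>t. g (x + t *\<^sub>R ?d) - t * (gradient g x \<bullet> ?d) - t\<^sup>2 * (G / 2 * (norm ?d)\<^sup>2)"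
  have "?\<phi> 1 \<le> ?\<phi> 0"
  proof (rule DERIV_nonpos_imp_nonincreasing[where f = ?\<phi>])
    fix t :: real assume t: "0 \<le> t" "t \<le> 1"
    let ?w = "x + t *\<^sub>R ?d"
    let ?e = "(gradient g ?w - gradient g x) \<bullet> ?d - t * (G * (norm ?d)\<^sup>2)"
    have "(gradient g ?w - gradient g x) \<bullet> ?d \<le> norm (gradient g ?w - gradient g x) * norm ?d"
      by (rule norm_cauchy_schwarz)
    also have "\<dots> \<le> G * norm (?w - x) * norm ?d"
      using lipschitz_onD[OF lip, of ?w x] by (intro mult_right_mono) (auto simp: dist_norm)
    also have "\<dots> = t * (G * (norm ?d)\<^sup>2)"
      using t by (simp add: power2_eq_square)
    finally have "?e \<le> 0" by simp
    moreover have "(?\<phi> has_real_derivative ?e) (at t)"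
      by (auto intro!: derivative_eq_intros has_real_derivative_along_line GDERIV_gradient_UNIV
          simp: inner_diff_left)
    ultimately show "\<exists>e. (?\<phi> has_real_derivative e) (at t) \<and> e \<le> 0" by blast
  qed simp
  then show ?thesis by simp
qed

text \<open>Baillon-Haddad: the gradient inequality from \<open>x\<close> and the descent lemma from
  \<open>y\<close> are compared at one common point, which sharpens convexity by a squared gradient
  difference.\<close>

lemma gradient_cocoercive:
  assumes mono: "monotone_operator_on UNIV (gradient g)"
    and lip: "G-lipschitz_on UNIV (gradient g)" and "G > 0"
  shows "(norm (gradient g x - gradient g y))\<^sup>2 \<le> G * ((gradient g x - gradient g y) \<bullet> (x - y))"
proof -
  have *: "g x + gradient g x \<bullet> (y - x) + (norm (gradient g y - gradient g x))\<^sup>2 / (2 * G) \<le> g y"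
    for x y
  proof -
    let ?w = "gradient g y - gradient g x"
    \<comment> \<open>The minimizer of the quadratic upper bound at \<open>y\<close> for
      \<open>g\<close> tilted by \<open>- gradient g x\<close>; the tilted gradient at
      \<open>y\<close> is \<open>?w\<close>.\<close>
    let ?z = "y - (1 / G) *\<^sub>R ?w"
    have "g x + gradient g x \<bullet> (?z - x) \<le> g ?z"
      using mono by (rule gradient_le_of_monotone)
    also have "\<dots> \<le> g y + gradient g y \<bullet> (?z - y) + G / 2 * (norm (?z - y))\<^sup>2"
      using lip by (rule descent_lemma)
    finally have "g x + gradient g x \<bullet> (?z - x) - gradient g y \<bullet> (?z - y) - G / 2 * (norm (?z - y))\<^sup>2 \<le> g y"
      by simp
    moreover have "gradient g x \<bullet> (?z - x) - gradient g y \<bullet> (?z - y)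
        = gradient g x \<bullet> (y - x) + (?w \<bullet> ?w) / G"
      by (simp add: inner_diff_left inner_diff_right inner_commute diff_divide_distrib add_divide_distrib)
    moreover have "G / 2 * (norm (?z - y))\<^sup>2 = (norm ?w)\<^sup>2 / (2 * G)"
      using \<open>G > 0\<close> by (simp add: power_divide power2_eq_square)
    ultimately show ?thesis
      by (simp add: power2_norm_eq_inner)
  qed
  let ?w = "gradient g x - gradient g y"
  \<comment> \<open>Adding the inequality with \<open>x\<close> and \<open>y\<close> exchanged
    cancels the function values.\<close>
  have "(norm ?w)\<^sup>2 / (2 * G) + (norm ?w)\<^sup>2 / (2 * G) \<le> ?w \<bullet> (x - y)"
    using *[of x y] *[of y x]
    by (simp add: norm_minus_commute inner_diff_left inner_diff_right)
  then show ?thesis using \<open>G > 0\<close> by (simp add: field_simps)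
qed

text \<open>Projection is nonexpansive, so expand the squared distance of the gradient steps.
  Cocoercivity absorbs the term in \<open>\<gamma>\<^sup>2\<close> into the cross term, leaving the
  weight \<open>\<gamma> * (2 - \<gamma> * G) \<ge> 0\<close> on which strong convexity acts; this
  covers all of \<open>\<gamma> * G \<le> 2\<close>.\<close>

lemma projected_gradient_step_contraction:
  assumes S: "closed S" "convex S" "S \<noteq> {}"
    and sc: "strongly_convex g \<eta>" and "\<eta> \<ge> 0"
    and lip: "G-lipschitz_on UNIV (gradient g)" and G: "G > 0"
    and \<gamma>: "0 \<le> \<gamma>" "\<gamma> * G \<le> 2"
  shows "(dist (closest_point S (s - \<gamma> *\<^sub>R gradient g s)) (closest_point S (t - \<gamma> *\<^sub>R gradient g t)))\<^sup>2
    \<le> (1 - \<gamma> * (2 - \<gamma> * G) * \<eta>) * (dist s t)\<^sup>2"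
proof -
  let ?w = "gradient g s - gradient g t"
  have strong: "\<eta> * (norm (u - v))\<^sup>2 \<le> (gradient g u - gradient g v) \<bullet> (u - v)" for u v
    using sc unfolding strongly_convex_def by blast
  have "monotone_operator_on UNIV (gradient g)"
    unfolding monotone_operator_on_def
    using strong \<open>\<eta> \<ge> 0\<close> by (meson order_trans mult_nonneg_nonneg zero_le_power2)
  then have co: "(norm ?w)\<^sup>2 \<le> G * (?w \<bullet> (s - t))"
    using lip G by (rule gradient_cocoercive)
  have "(dist (closest_point S (s - \<gamma> *\<^sub>R gradient g s)) (closest_point S (t - \<gamma> *\<^sub>R gradient g t)))\<^sup>2
      \<le> (dist (s - \<gamma> *\<^sub>R gradient g s) (t - \<gamma> *\<^sub>R gradient g t))\<^sup>2"
    using closest_point_lipschitz[OF S(2) S(1) S(3)] by (intro power_mono) auto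
  also have "\<dots> = (norm (s - t))\<^sup>2 - 2 * \<gamma> * (?w \<bullet> (s - t)) + \<gamma>\<^sup>2 * (norm ?w)\<^sup>2"
    unfolding dist_norm power2_norm_eq_inner
    by (simp add: inner_diff_left inner_diff_right inner_commute algebra_simps power2_eq_square)
  also have "\<dots> \<le> (norm (s - t))\<^sup>2 - 2 * \<gamma> * (?w \<bullet> (s - t)) + \<gamma>\<^sup>2 * (G * (?w \<bullet> (s - t)))"
    using co by (intro add_left_mono mult_left_mono) auto
  also have "\<dots> = (norm (s - t))\<^sup>2 - \<gamma> * (2 - \<gamma> * G) * (?w \<bullet> (s - t))"
    by (simp add: algebra_simps power2_eq_square)
  also have "\<dots> \<le> (norm (s - t))\<^sup>2 - \<gamma> * (2 - \<gamma> * G) * (\<eta> * (norm (s - t))\<^sup>2)"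
    using strong \<gamma> by (intro diff_left_mono mult_left_mono) auto
  finally show ?thesis by (simp add: dist_norm algebra_simps)
qed

text \<open>A negative directional derivative towards some \<open>y\<close> in \<open>S\<close>
  would let a short move along the segment, which stays in \<open>S\<close>, decrease
  \<open>g\<close>.\<close>

lemma is_arg_min_imp_VI_solution:
  assumes S: "convex S" and min: "is_arg_min g (\<lambda>t. t \<in> S) p"
  shows "p \<in> VI_solutions S (gradient g)"
proof -
  have p: "p \<in> S" and le: "\<And>y. y \<in> S \<Longrightarrow> g p \<le> g y"
    using min by (auto simp: is_arg_min_linorder)
  have "(y - p) \<bullet> gradient g p \<ge> 0" if y: "y \<in> S" for y
  proof (rule ccontr)
    assume "\<not> ?thesis"
    then have neg: "gradient g p \<bullet> (y - p) < 0" by (simp add: inner_commute)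
    have "((\<lambda>t. g (p + t *\<^sub>R (y - p))) has_real_derivative gradient g p \<bullet> (y - p)) (at 0)"
      using GDERIV_gradient_UNIV by (intro has_real_derivative_along_line) simp
    from DERIV_neg_dec_right[OF this neg] obtain d where d: "d > 0"
      "\<And>h. 0 < h \<Longrightarrow> h < d \<Longrightarrow> g (p + h *\<^sub>R (y - p)) < g p" by auto
    define h where "h = min (d / 2) 1"
    have h: "0 < h" "h < d" "h \<le> 1" using d(1) by (auto simp: h_def)
    have "p + h *\<^sub>R (y - p) = (1 - h) *\<^sub>R p + h *\<^sub>R y" by (simp add: algebra_simps)
    also have "\<dots> \<in> S" using S p y h by (intro convexD) auto
    finally show False using le d(2) h by force
  qed
  with p show ?thesis by (simp add: VI_solutions_def)
qed

end

section \<open>Quasi-Fejer sequences\<close>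

text \<open>A deterministic Robbins-Siegmund lemma: divided by the accumulated growth factor and
  corrected by the partial sums of \<open>\<beta>\<close>, the sequence \<open>a\<close> is
  decreasing and bounded below.\<close>

lemma quasi_Fejer_convergent:
  fixes a u \<alpha> \<beta> :: "nat \<Rightarrow> real"
  assumes nonneg: "\<And>k. a k \<ge> 0" "\<And>k. u k \<ge> 0" "\<And>k. \<alpha> k \<ge> 0" "\<And>k. \<beta> k \<ge> 0"
    and sum: "summable \<alpha>" "summable \<beta>"
    and step: "\<And>k. a (Suc k) \<le> (1 + \<alpha> k) * a k + \<beta> k - u k"
  shows "convergent a" "u \<longlonglongrightarrow> 0"
proof -
  \<comment> \<open>Summability of \<open>\<alpha>\<close> bounds this product by
    \<open>exp (suminf \<alpha>)\<close>, so it converges and the normalization can be undone in the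
    limit.\<close>
  define P where "P k = (\<Prod>i<k. 1 + \<alpha> i)" for k
  have P_Suc: "P (Suc k) = (1 + \<alpha> k) * P k" for k by (simp add: P_def)
  have P_ge: "P k \<ge> 1" for k
    unfolding P_def using nonneg by (intro prod_ge_1) auto
  have "P k \<le> exp (suminf \<alpha>)" for k
  proof -
    have "P k \<le> (\<Prod>i<k. exp (\<alpha> i))"
      unfolding P_def using nonneg by (intro prod_mono) (auto simp: add_nonneg_nonneg)
    also have "\<dots> = exp (\<Sum>i<k. \<alpha> i)" by (simp add: exp_sum)
    also have "\<dots> \<le> exp (suminf \<alpha>)" using sum_le_suminf[OF sum(1)] nonneg by simp
    finally show ?thesis .
  qed
  moreover have "incseq P"
  proof (rule incseq_SucI)
    fix k show "P k \<le> P (Suc k)"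
      using nonneg(3)[of k] P_ge[of k] by (simp add: P_Suc algebra_simps)
  qed
  ultimately obtain p where p: "P \<longlonglongrightarrow> p" using incseq_convergent by metis
  let ?b = "\<lambda>k. a k / P k - (\<Sum>i<k. \<beta> i)"
  have "a (Suc k) / P (Suc k) \<le> a k / P k + \<beta> k" for k
  proof -
    have pos: "P (Suc k) > 0" "P k > 0" using P_ge by (metis less_le_trans zero_less_one)+
    have "a (Suc k) \<le> (1 + \<alpha> k) * a k + \<beta> k * P (Suc k)"
      \<comment> \<open>Dropping \<open>u\<close> and inflating \<open>\<beta> k\<close> by
        \<open>P (Suc k) \<ge> 1\<close> makes the division below return exactly
        \<open>\<beta> k\<close>.\<close>
      using step[of k] nonneg(2)[of k] mult_left_mono[OF P_ge[of "Suc k"] nonneg(4)[of k]] by linarith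
    then have "a (Suc k) / P (Suc k) \<le> ((1 + \<alpha> k) * a k + \<beta> k * P (Suc k)) / P (Suc k)"
      using pos by (intro divide_right_mono) auto
    also have "\<dots> = a k / P k + \<beta> k"
      using pos nonneg(3)[of k] by (simp add: P_Suc field_simps add_nonneg_eq_0_iff)
    finally show ?thesis .
  qed
  then have dec: "decseq ?b" by (intro decseq_SucI) (simp add: algebra_simps)
  have lower: "?b k \<ge> - suminf \<beta>" for k
  proof -
    have "a k / P k \<ge> 0" using nonneg(1)[of k] P_ge[of k] by simp
    moreover have "(\<Sum>i<k. \<beta> i) \<le> suminf \<beta>"
      using nonneg(4) by (intro sum_le_suminf sum) auto
    ultimately show ?thesis by linarith
  qed
  obtain b where b: "?b \<longlonglongrightarrow> b"
    by (rule decseq_convergent[OF dec]) (rule allI[OF lower])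
  have "(\<lambda>k. (?b k + (\<Sum>i<k. \<beta> i)) * P k) \<longlonglongrightarrow> (b + suminf \<beta>) * p"
    by (intro tendsto_intros b p summable_LIMSEQ sum)
  moreover have "(?b k + (\<Sum>i<k. \<beta> i)) * P k = a k" for k
    using P_ge[of k] by simp
  ultimately have lim: "a \<longlonglongrightarrow> (b + suminf \<beta>) * p" by simp
  then show "convergent a" by (auto simp: convergent_def)
  \<comment> \<open>Once \<open>a\<close> converges, the slack that dominates \<open>u\<close> tends
    to 0.\<close>
  have "(\<lambda>k. (1 + \<alpha> k) * a k + \<beta> k - a (Suc k)) \<longlonglongrightarrow>
      (1 + 0) * ((b + suminf \<beta>) * p) + 0 - (b + suminf \<beta>) * p"
    by (intro tendsto_intros lim LIMSEQ_Suc summable_LIMSEQ_zero sum)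
  then have gap: "(\<lambda>k. (1 + \<alpha> k) * a k + \<beta> k - a (Suc k)) \<longlonglongrightarrow> 0" by simp
  have "u k \<le> (1 + \<alpha> k) * a k + \<beta> k - a (Suc k)" for k
    using step[of k] by linarith
  then show "u \<longlonglongrightarrow> 0"
    by (intro tendsto_sandwich[OF _ _ tendsto_const gap] always_eventually allI nonneg)
qed

section \<open>The joint scheme\<close>

text \<open>Separates the extragradient analysis from the rule generating \<open>\<theta>\<close>:
  the parameter enters through the summability of its errors.\<close>

lemma perturbed_extragradient_convergence:
  fixes X :: "'a::euclidean_space set" and \<Theta> :: "'b::real_normed_vector set"
  assumes X: "closed X" "convex X"
    and mono: "\<And>t. t \<in> \<Theta> \<Longrightarrow> monotone_operator_on X (\<lambda>u. F u t)"
    and lip_x: "\<And>t. t \<in> \<Theta> \<Longrightarrow> L-lipschitz_on X (\<lambda>u. F u t)"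
    and lip_\<theta>: "\<And>u. u \<in> X \<Longrightarrow> M-lipschitz_on \<Theta> (F u)"
    and sol: "VI_solutions X (\<lambda>u. F u s) \<noteq> {}"
    and s: "s \<in> \<Theta>" and \<theta>: "\<And>k. \<theta> k \<in> \<Theta>"
    and summ: "summable (\<lambda>k. norm (\<theta> k - s))"
    and \<tau>: "\<tau> > 0" "\<tau>\<^sup>2 * L\<^sup>2 < 1"
    and x0: "x 0 \<in> X"
    and z: "\<And>k. z (Suc k) = closest_point X (x k - \<tau> *\<^sub>R F (x k) (\<theta> k))"
    and x: "\<And>k. x (Suc k) = closest_point X (x k - \<tau> *\<^sub>R F (z (Suc k)) (\<theta> k))"
  shows "\<exists>x_lim \<in> VI_solutions X (\<lambda>u. F u s). x \<longlonglongrightarrow> x_lim"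
proof -
  let ?S = "VI_solutions X (\<lambda>u. F u s)"
  define e where "e k = norm (\<theta> k - s)" for k
  \<comment> \<open>\<open>\<delta>\<close> is the descent coefficient of
    \<open>extragradient_step\<close>; half of it will pay for the perturbation.
    \<open>\<alpha>\<close> is the size of the perturbation, and \<open>\<beta>\<close> collects
    what Young's inequality leaves over.\<close>
  define \<delta> where "\<delta> = 1 - \<tau>\<^sup>2 * L\<^sup>2"
  define r where "r k = norm (x k - z (Suc k))" for k
  define \<alpha> where "\<alpha> k = \<tau> * M * e k" for k
  define \<beta> where "\<beta> k = \<alpha> k + 2 / \<delta> * (\<alpha> k)\<^sup>2" for k
  have \<delta>: "\<delta> > 0" using \<tau> by (simp add: \<delta>_def)
  have Xne: "X \<noteq> {}" using x0 by blast
  have inX: "closest_point X a \<in> X" for a by (rule closest_point_in_set[OF X(1) Xne])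
  have xX: "x k \<in> X" for k using x0 x inX by (cases k) auto
  have zX: "z (Suc k) \<in> X" for k by (simp add: z inX)
  have M: "M \<ge> 0" using lip_\<theta>[OF x0] by (rule lipschitz_on_nonneg)
  have e_sum: "summable e" using summ by (simp add: e_def[abs_def])
  have \<alpha>_nonneg: "\<alpha> k \<ge> 0" for k using \<tau> M by (simp add: \<alpha>_def e_def)
  have \<alpha>_sum: "summable \<alpha>" unfolding \<alpha>_def[abs_def] by (intro summable_mult e_sum)
  have "summable (\<lambda>k. (\<alpha> k)\<^sup>2)"
  proof (rule summable_comparison_test_ev[OF _ \<alpha>_sum])
    have "eventually (\<lambda>k. \<alpha> k < 1) sequentially"
      using summable_LIMSEQ_zero[OF \<alpha>_sum] by (rule order_tendstoD) simp
    then show "eventually (\<lambda>k. norm ((\<alpha> k)\<^sup>2) \<le> \<alpha> k) sequentially"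
      by eventually_elim (use \<alpha>_nonneg in \<open>auto simp: power2_eq_square mult_left_le\<close>)
  qed
  then have \<beta>_sum: "summable \<beta>"
    unfolding \<beta>_def[abs_def] by (intro summable_add summable_mult \<alpha>_sum)
  have step: "(norm (x (Suc k) - p))\<^sup>2
      \<le> (1 + \<alpha> k) * (norm (x k - p))\<^sup>2 + \<beta> k - \<delta> / 2 * (r k)\<^sup>2" if p: "p \<in> ?S" for p k
  proof -
    have pX: "p \<in> X" using p by (simp add: VI_solutions_def)
    let ?n = "norm (x k - p)"
    \<comment> \<open>\<open>p\<close> solves the problem for \<open>s\<close> while the step uses
      \<open>\<theta> k\<close>; subtracting this nonpositive term turns the residual into a
      parameter difference.\<close>
    have "F p s \<bullet> (p - z (Suc k)) \<le> 0"
      using p zX[of k] unfolding VI_solutions_def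
      by (auto simp: inner_diff_left inner_diff_right inner_commute)
    then have "F p (\<theta> k) \<bullet> (p - z (Suc k)) \<le> (F p (\<theta> k) - F p s) \<bullet> (p - z (Suc k))"
      by (simp add: inner_diff_left)
    also have "\<dots> \<le> norm (F p (\<theta> k) - F p s) * norm (p - z (Suc k))"
      by (rule norm_cauchy_schwarz)
    also have "\<dots> \<le> M * e k * (?n + r k)"
      using lipschitz_onD[OF lip_\<theta>[OF pX] \<theta>[of k] s] M
        norm_triangle_ineq[of "p - x k" "x k - z (Suc k)"]
      by (intro mult_mono) (auto simp: e_def dist_norm r_def norm_minus_commute)
    finally have "2 * \<tau> * (F p (\<theta> k) \<bullet> (p - z (Suc k))) \<le> 2 * \<tau> * (M * e k * (?n + r k))"
      using \<tau> by (intro mult_left_mono) auto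
    also have "\<dots> = \<alpha> k * (2 * ?n) + 2 * (\<alpha> k * r k)"
      by (simp add: \<alpha>_def algebra_simps)
    \<comment> \<open>The linear term in \<open>?n\<close> is traded for a multiplicative and an
      additive error; the weight in Young's inequality for \<open>\<alpha> k * r k\<close> is chosen
      to spend exactly \<open>\<delta> / 2\<close> on \<open>(r k)\<^sup>2\<close>.\<close>
    also have "\<dots> \<le> \<alpha> k * (1 + ?n\<^sup>2) + (\<delta> / 2 * (r k)\<^sup>2 + 2 / \<delta> * (\<alpha> k)\<^sup>2)"
    proof (intro add_mono mult_left_mono \<alpha>_nonneg)
      show "2 * ?n \<le> 1 + ?n\<^sup>2" using sum_squares_bound[of 1 ?n] by simp
      have "0 \<le> (\<delta> * r k - 2 * \<alpha> k)\<^sup>2 / (2 * \<delta>)" using \<delta> by simp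
      also have "\<dots> = \<delta> / 2 * (r k)\<^sup>2 + 2 / \<delta> * (\<alpha> k)\<^sup>2 - 2 * (\<alpha> k * r k)"
        using \<delta> by (simp add: power2_eq_square field_simps)
      finally show "2 * (\<alpha> k * r k) \<le> \<delta> / 2 * (r k)\<^sup>2 + 2 / \<delta> * (\<alpha> k)\<^sup>2" by simp
    qed
    finally have "2 * \<tau> * (F p (\<theta> k) \<bullet> (p - z (Suc k)))
      \<le> \<alpha> k * ?n\<^sup>2 + \<beta> k + \<delta> / 2 * (r k)\<^sup>2" by (simp add: \<beta>_def algebra_simps)
    moreover have "(norm (x (Suc k) - p))\<^sup>2
      \<le> ?n\<^sup>2 - \<delta> * (r k)\<^sup>2 + 2 * \<tau> * (F p (\<theta> k) \<bullet> (p - z (Suc k)))"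
      unfolding \<delta>_def r_def
      using \<tau> by (intro extragradient_step[OF X mono[OF \<theta>] lip_x[OF \<theta>] _ xX pX z x]) simp
    ultimately show ?thesis by (simp add: algebra_simps)
  qed
  \<comment> \<open>Stated for every solution: it is applied first to an arbitrary one for
    boundedness, later to the cluster point.\<close>
  have fejer: "convergent (\<lambda>k. (norm (x k - p))\<^sup>2)" "(\<lambda>k. \<delta> / 2 * (r k)\<^sup>2) \<longlonglongrightarrow> 0" if "p \<in> ?S" for p
  proof -
    have "\<delta> / 2 * (r k)\<^sup>2 \<ge> 0" "\<beta> k \<ge> 0" for k
      using \<delta> \<alpha>_nonneg by (simp_all add: \<beta>_def)
    note * = quasi_Fejer_convergent[where a = "\<lambda>k. (norm (x k - p))\<^sup>2",
        OF zero_le_power2 this(1) \<alpha>_nonneg this(2) \<alpha>_sum \<beta>_sum step[OF that]]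
    show "convergent (\<lambda>k. (norm (x k - p))\<^sup>2)" "(\<lambda>k. \<delta> / 2 * (r k)\<^sup>2) \<longlonglongrightarrow> 0"
      by (fact *)+
  qed
  obtain p where p: "p \<in> ?S" using sol by blast
  have "(\<lambda>k. 2 / \<delta> * (\<delta> / 2 * (r k)\<^sup>2)) \<longlonglongrightarrow> 2 / \<delta> * 0"
    by (intro tendsto_intros fejer(2)[OF p])
  then have "(\<lambda>k. sqrt ((r k)\<^sup>2)) \<longlonglongrightarrow> sqrt 0"
    using \<delta> by (intro tendsto_real_sqrt) simp
  then have r0: "(\<lambda>k. x k - z (Suc k)) \<longlonglongrightarrow> 0"
    by (simp add: r_def tendsto_norm_zero_iff)
  have "Bseq (\<lambda>k. (norm (x k - p))\<^sup>2)"
    using fejer(1)[OF p] by (rule convergent_imp_Bseq)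
  then obtain K where K: "\<And>k. (norm (x k - p))\<^sup>2 \<le> K" unfolding Bseq_def by auto
  have "bounded (range x)"
  proof (rule boundedI)
    fix y assume "y \<in> range x"
    then obtain k where k: "y = x k" by blast
    have "norm (x k - p) \<le> sqrt K" using K[of k] real_le_rsqrt by blast
    then show "norm y \<le> norm p + sqrt K"
      using norm_triangle_ineq[of "x k - p" p] by (simp add: k)
  qed
  then obtain q f where f: "strict_mono f" and q: "(x \<circ> f) \<longlonglongrightarrow> q"
    using bounded_imp_convergent_subsequence by blast
  have qX: "q \<in> X" using closed_sequentially[OF X(1) _ q] xX by simp
  have \<theta>_lim: "(\<lambda>k. norm (\<theta> k - s)) \<longlonglongrightarrow> 0" using summ by (rule summable_LIMSEQ_zero)
  \<comment> \<open>Inserting \<open>F q (\<theta> (f k))\<close> splits the error into one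
    Lipschitz estimate per argument.\<close>
  have F_lim: "(\<lambda>k. F (x (f k)) (\<theta> (f k))) \<longlonglongrightarrow> F q s"
  proof -
    have le: "norm (F (x (f k)) (\<theta> (f k)) - F q s) \<le> L * norm (x (f k) - q) + M * norm (\<theta> (f k) - s)" for k
      using lipschitz_onD[OF lip_x[OF \<theta>] xX qX, of "f k" "f k"] lipschitz_onD[OF lip_\<theta>[OF qX] \<theta> s, of "f k"]
        norm_triangle_ineq[of "F (x (f k)) (\<theta> (f k)) - F q (\<theta> (f k))" "F q (\<theta> (f k)) - F q s"]
      by (simp add: dist_norm)
    have "(\<lambda>k. L * norm (x (f k) - q) + M * norm (\<theta> (f k) - s)) \<longlonglongrightarrow> L * 0 + M * 0"
      using q LIMSEQ_subseq_LIMSEQ[OF \<theta>_lim f]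
      by (intro tendsto_intros) (auto simp: o_def tendsto_norm_zero_iff LIM_zero_iff)
    then have "(\<lambda>k. F (x (f k)) (\<theta> (f k)) - F q s) \<longlonglongrightarrow> 0"
      by (intro Lim_null_comparison[OF always_eventually[OF allI[OF le]]]) simp
    then show ?thesis by (simp add: LIM_zero_iff)
  qed
  \<comment> \<open>These are the points \<open>z (Suc (f k))\<close>. Their limit is computed
    twice, by continuity of the projection and from \<open>x k - z (Suc k)\<close> tending to 0;
    equating the two makes \<open>q\<close> a fixed point.\<close>
  have "(\<lambda>k. closest_point X (x (f k) - \<tau> *\<^sub>R F (x (f k)) (\<theta> (f k))))
      \<longlonglongrightarrow> closest_point X (q - \<tau> *\<^sub>R F q s)"
    using q by (intro isCont_tendsto_compose[OF continuous_at_closest_point[OF X(2,1) Xne]]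
        tendsto_intros F_lim) (simp add: o_def)
  moreover have "(\<lambda>k. x (f k) - (x (f k) - z (Suc (f k)))) \<longlonglongrightarrow> q - 0"
    using q LIMSEQ_subseq_LIMSEQ[OF r0 f] by (intro tendsto_diff) (simp_all add: o_def)
  ultimately have "closest_point X (q - \<tau> *\<^sub>R F q s) = q"
    by (intro LIMSEQ_unique) (simp_all flip: z)
  then have q_sol: "q \<in> ?S"
    using VI_solutions_iff_closest_point[OF X \<tau>(1) qX] by blast
  obtain l where l: "(\<lambda>k. (norm (x k - q))\<^sup>2) \<longlonglongrightarrow> l"
    using fejer(1)[OF q_sol] by (auto simp: convergent_def)
  have "(\<lambda>k. (norm (x (f k) - q))\<^sup>2) \<longlonglongrightarrow> (norm (q - q))\<^sup>2"
    using q by (intro tendsto_intros) (simp add: o_def)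
  \<comment> \<open>The squared distances to \<open>q\<close> converge along the whole sequence, so
    the subsequence already forces their limit to be 0.\<close>
  then have "l = (norm (q - q))\<^sup>2"
    by (rule LIMSEQ_unique[OF LIMSEQ_subseq_LIMSEQ[OF l f, unfolded o_def]])
  then have "(\<lambda>k. sqrt ((norm (x k - q))\<^sup>2)) \<longlonglongrightarrow> sqrt 0"
    using l by (intro tendsto_real_sqrt) simp
  then have "x \<longlonglongrightarrow> q" by (simp add: tendsto_norm_zero_iff LIM_zero_iff)
  with q_sol show ?thesis by blast
qed

theorem theorem16:
  fixes X :: "(real ^ 'n) set"
    and \<Theta> :: "(real ^ 'm) set"
    and F :: "real ^ 'n \<Rightarrow> real ^ 'm \<Rightarrow> real ^ 'n"
    and g :: "real ^ 'm \<Rightarrow> real"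
    and \<eta>\<^sub>g G\<^sub>g \<gamma>\<^sub>g \<tau> L_x L_\<theta> :: real
    and x z :: "nat \<Rightarrow> real ^ 'n"
    and \<theta> :: "nat \<Rightarrow> real ^ 'm"
    and \<theta>_star :: "real ^ 'm"
  assumes X: "X \<noteq> {}" "closed X" "convex X"
    and \<Theta>: "\<Theta> \<noteq> {}" "closed \<Theta>" "convex \<Theta>" "bounded \<Theta>"
    and g_diff: "g differentiable_on UNIV"
    and g_sc: "\<eta>\<^sub>g > 0" "strongly_convex g \<eta>\<^sub>g"
    and g_lip: "G\<^sub>g-lipschitz_on UNIV (gradient g)"
    and F_mono: "\<And>t. t \<in> \<Theta> \<Longrightarrow> monotone_operator_on X (\<lambda>u. F u t)"
    and F_lip_x: "\<And>t. t \<in> \<Theta> \<Longrightarrow> L_x-lipschitz_on X (\<lambda>u. F u t)"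
    and F_lip_\<theta>: "\<And>u. u \<in> X \<Longrightarrow> L_\<theta>-lipschitz_on \<Theta> (F u)"
    and minimizer: "is_arg_min g (\<lambda>t. t \<in> \<Theta>) \<theta>_star"
    and sol_nonempty: "VI_solutions X (\<lambda>u. F u \<theta>_star) \<noteq> {}"
    and step_g: "0 < \<gamma>\<^sub>g" "\<gamma>\<^sub>g < 2 / G\<^sub>g"
    and scheme: "joint_extragradient X \<Theta> F g \<tau> \<gamma>\<^sub>g x z \<theta>"
    and \<tau>_pos: "\<tau> > 0"
    and \<tau>_bound: "L_x\<^sup>2 + 2 * L_\<theta> * norm (\<theta> 0 - \<theta>_star) \<noteq> 0 \<Longrightarrow>
      \<tau>\<^sup>2 < 1 / (L_x\<^sup>2 + 2 * L_\<theta> * norm (\<theta> 0 - \<theta>_star))"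
  shows "(\<exists>x_lim \<in> VI_solutions X (\<lambda>u. F u \<theta>_star). x \<longlonglongrightarrow> x_lim) \<and> \<theta> \<longlonglongrightarrow> \<theta>_star"
proof -
  from scheme have x0: "x 0 \<in> X" and \<theta>0: "\<theta> 0 \<in> \<Theta>"
    and z: "\<And>k. z (Suc k) = closest_point X (x k - \<tau> *\<^sub>R F (x k) (\<theta> k))"
    and x: "\<And>k. x (Suc k) = closest_point X (x k - \<tau> *\<^sub>R F (z (Suc k)) (\<theta> k))"
    and \<theta>_Suc: "\<And>k. \<theta> (Suc k) = closest_point \<Theta> (\<theta> k - \<gamma>\<^sub>g *\<^sub>R gradient g (\<theta> k))"
    unfolding joint_extragradient_def by blast+
  have \<theta>: "\<theta> k \<in> \<Theta>" for k
    using \<theta>0 \<theta>_Suc closest_point_in_set[OF \<Theta>(2,1)] by (cases k) auto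
  have star: "\<theta>_star \<in> \<Theta>" using minimizer by (simp add: is_arg_min_def)
  \<comment> \<open>Division by zero gives 0, so a nonempty steplength range also excludes
    \<open>G\<^sub>g = 0\<close>.\<close>
  have "2 / G\<^sub>g > 0" using step_g by linarith
  then have G: "G\<^sub>g > 0" by (simp add: zero_less_divide_iff)
  then have \<gamma>G: "\<gamma>\<^sub>g * G\<^sub>g < 2" using step_g by (simp add: field_simps)
  \<comment> \<open>The root of the contraction factor for squared distances; \<open>max 0\<close>
    makes the radicand nonnegative without comparing \<open>\<eta>\<^sub>g\<close> and
    \<open>G\<^sub>g\<close>.\<close>
  define c where "c = sqrt (max 0 (1 - \<gamma>\<^sub>g * (2 - \<gamma>\<^sub>g * G\<^sub>g) * \<eta>\<^sub>g))"
  have c: "0 \<le> c" "c < 1" using step_g g_sc \<gamma>G by (auto simp: c_def)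
  have fixed: "closest_point \<Theta> (\<theta>_star - \<gamma>\<^sub>g *\<^sub>R gradient g \<theta>_star) = \<theta>_star"
    using VI_solutions_iff_closest_point[OF \<Theta>(2,3) step_g(1) star]
      is_arg_min_imp_VI_solution[OF g_diff \<Theta>(3) minimizer] by blast
  have contr: "dist (\<theta> (Suc k)) \<theta>_star \<le> c * dist (\<theta> k) \<theta>_star" for k
  proof -
    have "(dist (\<theta> (Suc k)) \<theta>_star)\<^sup>2
        \<le> (1 - \<gamma>\<^sub>g * (2 - \<gamma>\<^sub>g * G\<^sub>g) * \<eta>\<^sub>g) * (dist (\<theta> k) \<theta>_star)\<^sup>2"
      using projected_gradient_step_contraction[OF g_diff \<Theta>(2,3,1) g_sc(2) _ g_lip G, of \<gamma>\<^sub>g "\<theta> k" \<theta>_star]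
        g_sc(1) step_g(1) \<gamma>G by (simp add: fixed \<theta>_Suc)
    also have "\<dots> \<le> c\<^sup>2 * (dist (\<theta> k) \<theta>_star)\<^sup>2"
      by (intro mult_right_mono) (auto simp: c_def)
    finally have "(dist (\<theta> (Suc k)) \<theta>_star)\<^sup>2 \<le> (c * dist (\<theta> k) \<theta>_star)\<^sup>2"
      by (simp add: power_mult_distrib)
    then show ?thesis by (rule power2_le_imp_le) (simp add: c)
  qed
  have geom: "norm (\<theta> k - \<theta>_star) \<le> c ^ k * dist (\<theta> 0) \<theta>_star" for k
  proof (induction k)
    case (Suc k)
    have "norm (\<theta> (Suc k) - \<theta>_star) \<le> c * norm (\<theta> k - \<theta>_star)"
      using contr[of k] by (simp add: dist_norm)
    also have "\<dots> \<le> c * (c ^ k * dist (\<theta> 0) \<theta>_star)"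
      using Suc.IH c(1) by (rule mult_left_mono)
    finally show ?case by (simp add: mult.assoc)
  qed (simp add: dist_norm)
  have summ: "summable (\<lambda>k. norm (\<theta> k - \<theta>_star))"
  proof (rule summable_comparison_test')
    show "summable (\<lambda>k. c ^ k * dist (\<theta> 0) \<theta>_star)"
      using c by (intro summable_mult2 summable_geometric) simp
    show "norm (norm (\<theta> k - \<theta>_star)) \<le> c ^ k * dist (\<theta> 0) \<theta>_star" if "k \<ge> 0" for k
      using geom by simp
  qed
  have "\<theta> \<longlonglongrightarrow> \<theta>_star"
    using summable_LIMSEQ_zero[OF summ] by (simp add: tendsto_norm_zero_iff LIM_zero_iff)
  \<comment> \<open>The form of the steplength condition that keeps the descent coefficient
    positive.\<close>
  moreover have "\<tau>\<^sup>2 * L_x\<^sup>2 < 1"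
  proof -
    let ?D = "L_x\<^sup>2 + 2 * L_\<theta> * norm (\<theta> 0 - \<theta>_star)"
    have "L_\<theta> \<ge> 0" using F_lip_\<theta>[OF x0] by (rule lipschitz_on_nonneg)
    then have D: "L_x\<^sup>2 \<le> ?D" by simp
    show ?thesis
    \<comment> \<open>A zero denominator stands for an infinite bound on \<open>\<tau>\<close>,
      whereas \<open>1 / 0\<close> is 0 here; in that case \<open>L_x\<close> vanishes and the claim
      is immediate.\<close>
    proof (cases "?D = 0")
      case True
      then have "L_x\<^sup>2 = 0" using D zero_le_power2[of L_x] by linarith
      then show ?thesis by simp
    next
      case False
      then have "?D > 0" using D zero_le_power2[of L_x] by linarith
      then have "\<tau>\<^sup>2 * ?D < 1" using \<tau>_bound[OF False] by (simp add: pos_less_divide_eq)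
      moreover have "\<tau>\<^sup>2 * L_x\<^sup>2 \<le> \<tau>\<^sup>2 * ?D" using D by (intro mult_left_mono) auto
      ultimately show ?thesis by linarith
    qed
  qed
  ultimately show ?thesis
    using perturbed_extragradient_convergence[OF X(2,3) F_mono F_lip_x F_lip_\<theta> sol_nonempty star \<theta>
        summ \<tau>_pos _ x0 z x] by blast
qed

end
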